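(* For every permutation $\tau$ of $[n]$, \[ \mathcal F_\tau=P_{\{\tau^{-1}(1)\}|\{\tau^{-1}(2)\}|\cdots|\{\tau^{-1}(n)\}}. \]
   Context: Notation: $x_1,x_2,\dots$ are non-commuting variables, and $x_w=x_{w_1}\cdots x_{w_n}$ for a word $w$ of positive integers. Standardization: the standardization $\mathrm{std}(w)$ of a word $w$ of length $n$ is the permutation of $[n]$ obtained by replacing the letters of $w$ by $1,\dots,n$ in increasing order of value, with equal letters numbered from left to right. The fundamental basis of $\mathrm{FQSym}$, realized in non-commuting variables, is $\mathcal F_\tau=\sum_{w:\ \mathrm{std}(w)=\tau}x_w$. Set compositions: a set composition $\Phi=B_1|\cdots|B_k$ of $n$ is a sequence of disjoint nonempty sets with union $[n]$. For a word $w$ with distinct values $v_1<\dots<v_k$, $\varrho(w)=B_1|\cdots|B_k$ with $B_r=\{i:w_i=v_r\}$, and $M_\Phi=\sum_{\varrho(w)=\Phi}x_w$. Order on blocks: $A>_{\mathcal D}B$ if $|A|>|B|$, or $|A|=|B|$ and $\min A<\min B$. LDD fillings: $\mathsf{LDD}(\Phi)$ is the set of placements of $B_i$ in row $i$ of a matrix such that the following hold. - $B_1$ is in column 1. - $B_{i+1}$ is in the same column as $B_i$ or the next column if $B_i>_{\mathcal D}B_{i+1}$, and in the next column otherwise. $\mathsf{col}(\tilde{\mathsf F})$ lists, left to right, the unions of the blocks in the nonempty columns. Then $P_\Phi=\sum_{\tilde{\mathsf F}\in\mathsf{LDD}(\Phi)}M_{\mathsf{col}(\tilde{\mathsf F})}$.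 *)

theory Defs
  imports Main "HOL-Combinatorics.Permutations"
begin

text \<open>Words are lists of naturals; positions are counted from 1, so the letter in position
  \<open>i\<close> of \<open>w\<close> is \<open>w ! (i - 1)\<close>.  A formal power series in non-commuting variables is
  its coefficient function, which sends \<open>w\<close> to the coefficient of \<open>x\<^sub>w\<close>.\<close>

type_synonym 'a nc_series = "nat list \<Rightarrow> 'a"

definition pos_word :: "nat list \<Rightarrow> bool" where
  "pos_word w \<longleftrightarrow> (\<forall>a \<in> set w. 0 < a)"

text \<open>The formal, possibly infinite, sum of the distinct monomials \<open>x\<^sub>w\<close> for \<open>w \<in> S\<close>.\<close>

definition monomial_sum :: "nat list set \<Rightarrow> 'a::comm_ring_1 nc_series" where
  "monomial_sum S = (\<lambda>w. if w \<in> S then 1 else 0)"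

text \<open>The letter in position \<open>i\<close> receives as its number the count of letters numbered no later:
  smaller letters, and equal letters weakly to the left.  As is usual for permutations of
  \<open>{1..n}\<close> viewed as functions on \<open>nat\<close>, all points outside are fixed.\<close>

definition std :: "nat list \<Rightarrow> nat \<Rightarrow> nat" where
  "std w i =
     (if i \<in> {1..length w}
      then card {j \<in> {1..length w}.
             w ! (j - 1) < w ! (i - 1) \<or> (w ! (j - 1) = w ! (i - 1) \<and> j \<le> i)}
      else i)"

text \<open>The size \<open>n\<close> is an explicit argument: a permutation of \<open>{1..n}\<close>, as a function on
  \<open>nat\<close>, does not determine \<open>n\<close>.\<close>

definition FQSym_F :: "nat \<Rightarrow> (nat \<Rightarrow> nat) \<Rightarrow> 'a::comm_ring_1 nc_series" where
  "FQSym_F n \<tau> = monomial_sum {w. pos_word w \<and> length w = n \<and> std w = \<tau>}"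

definition set_composition :: "nat \<Rightarrow> nat set list \<Rightarrow> bool" where
  "set_composition n \<Phi> \<longleftrightarrow>
     {} \<notin> set \<Phi> \<and> \<Union>(set \<Phi>) = {1..n} \<and>
     (\<forall>i < length \<Phi>. \<forall>j < length \<Phi>. i \<noteq> j \<longrightarrow> \<Phi> ! i \<inter> \<Phi> ! j = {})"

definition rho :: "nat list \<Rightarrow> nat set list" where
  "rho w = map (\<lambda>v. {i \<in> {1..length w}. w ! (i - 1) = v}) (sorted_list_of_set (set w))"

definition M :: "nat set list \<Rightarrow> 'a::comm_ring_1 nc_series" where
  "M \<Phi> = monomial_sum {w. pos_word w \<and> rho w = \<Phi>}"

definition block_gt :: "nat set \<Rightarrow> nat set \<Rightarrow> bool" where
  "block_gt A B \<longleftrightarrow> card A > card B \<or> (card A = card B \<and> Min A < Min B)"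

text \<open>A filling is encoded by its list of columns: the block \<open>\<Phi> ! i\<close> is placed in column
  \<open>c ! i\<close>.  Columns are numbered from 1, while the list indices (rows) start at 0.\<close>

definition LDD :: "nat set list \<Rightarrow> nat list set" where
  "LDD \<Phi> =
     {c. length c = length \<Phi> \<and>
         (\<Phi> \<noteq> [] \<longrightarrow> c ! 0 = 1) \<and>
         (\<forall>i. Suc i < length \<Phi> \<longrightarrow>
            (if block_gt (\<Phi> ! i) (\<Phi> ! Suc i)
             then c ! Suc i = c ! i \<or> c ! Suc i = c ! i + 1
             else c ! Suc i = c ! i + 1))}"

definition col :: "nat set list \<Rightarrow> nat list \<Rightarrow> nat set list" where
  "col \<Phi> c =
     map (\<lambda>k. \<Union>{\<Phi> ! i | i. i < length \<Phi> \<and> c ! i = k}) (sorted_list_of_set (set c))"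

definition P :: "nat set list \<Rightarrow> 'a::comm_ring_1 nc_series" where
  "P \<Phi> = (\<lambda>w. \<Sum>c \<in> LDD \<Phi>. M (col \<Phi> c) w)"

text \<open>The sum defining \<open>P\<close> is indeed a finite one.\<close>

lemma finite_LDD: "finite (LDD \<Phi>)"
proof (rule finite_subset)
  show "LDD \<Phi> \<subseteq> {c. set c \<subseteq> {..length \<Phi>} \<and> length c = length \<Phi>}"
  proof
    fix c assume c: "c \<in> LDD \<Phi>"
    then have len: "length c = length \<Phi>" by (simp add: LDD_def)
    have "c ! i \<le> Suc i" if "i < length \<Phi>" for i
      using that
    proof (induction i)
      case 0
      then show ?case using c by (auto simp: LDD_def)
    next
      case (Suc i)
      then have "c ! Suc i = c ! i \<or> c ! Suc i = c ! i + 1"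
        using c unfolding LDD_def by (auto split: if_splits)
      then show ?case using Suc by auto
    qed
    then have "set c \<subseteq> {..length \<Phi>}"
      using len by (fastforce simp: in_set_conv_nth)
    with len show "c \<in> {c. set c \<subseteq> {..length \<Phi>} \<and> length c = length \<Phi>}" by simp
  qed
  show "finite {c. set c \<subseteq> {..length \<Phi>} \<and> length c = length \<Phi>}"
    by (rule finite_lists_length_eq) simp
qed

lemma set_composition_singletons:
  assumes "\<tau> permutes {1..n}"
  shows "set_composition n (map (\<lambda>i. {inv \<tau> i}) [1..<Suc n])"
proof -
  have p: "inv \<tau> permutes {1..n}" using assms by (rule permutes_inv)
  have "\<Union>(set (map (\<lambda>i. {inv \<tau> i}) [1..<Suc n])) = inv \<tau> ` {1..n}"
    by (simp add: atLeastLessThanSuc_atLeastAtMost UNION_singleton_eq_range del: upt_Suc)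
  also have "\<dots> = {1..n}" using p by (rule permutes_image)
  finally show ?thesis
    using permutes_inj[OF p]
    by (auto simp: set_composition_def inj_eq simp del: upt_Suc)
qed

end

theory Submission
  imports Defs
begin

text \<open>Write \<open>\<sigma> = inv \<tau>\<close>.  A word \<open>w\<close> standardizes to \<open>\<tau>\<close> iff reading it in the order
  \<open>\<sigma> 1, \<sigma> 2, \<dots>\<close> gives a weakly increasing sequence that increases strictly wherever \<open>\<sigma>\<close>
  descends.  The column numbers of a filling form such a sequence with steps 0 or 1, so they are
  the packed words standardizing to \<open>\<tau>\<close>, and every \<open>w\<close> with \<open>std w = \<tau>\<close> has the same
  \<open>rho\<close> as exactly one of them.\<close>

section \<open>Words with the same letter comparisons, and their set compositions\<close>

text \<open>Equality of packed words, expressed by pairwise comparisons so that no packing has to be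
  constructed. The relation \<open>\<le>\<close> alone suffices, since it determines both
  \<open><\<close> and \<open>=\<close>.\<close>

definition same_order :: "nat list \<Rightarrow> nat list \<Rightarrow> bool" where
  "same_order u w \<longleftrightarrow> length u = length w \<and>
     (\<forall>p < length w. \<forall>q < length w. u ! p \<le> u ! q \<longleftrightarrow> w ! p \<le> w ! q)"

lemma same_order_sym: "same_order u w \<Longrightarrow> same_order w u"
  by (auto simp: same_order_def)

lemma same_order_trans: "same_order u v \<Longrightarrow> same_order v w \<Longrightarrow> same_order u w"
  by (auto simp: same_order_def)

lemma same_order_eq_iff:
  assumes "same_order u w" "p < length w" "q < length w"
  shows "u ! p = u ! q \<longleftrightarrow> w ! p = w ! q"
  using assms unfolding same_order_def by (metis order_antisym order_refl)

lemma length_rho: "length (rho w) = card (set w)"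
  by (simp add: rho_def)

lemma mem_rho_nth:
  assumes "r < length (rho w)"
  shows "p \<in> rho w ! r \<longleftrightarrow> p \<in> {1..length w} \<and> w ! (p - 1) = sorted_list_of_set (set w) ! r"
  using assms by (auto simp: rho_def)

lemma mem_rho_ex:
  assumes "p \<in> {1..length w}"
  shows "\<exists>r < length (rho w). p \<in> rho w ! r"
proof -
  have "w ! (p - 1) \<in> set (sorted_list_of_set (set w))"
    using assms by auto
  then obtain r where "r < length (rho w)" "sorted_list_of_set (set w) ! r = w ! (p - 1)"
    by (metis in_set_conv_nth length_rho length_sorted_list_of_set)
  then show ?thesis using assms mem_rho_nth by metis
qed

lemma Union_rho: "\<Union>(set (rho w)) = {1..length w}"
  by (auto simp: rho_def)

text \<open>The blocks of \<open>rho w\<close> are listed by strictly increasing letter, so the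
  index of a block carries the same order information as its letter.\<close>

lemma rho_nth_le_iff:
  assumes "r < length (rho w)" "s < length (rho w)" "p \<in> rho w ! r" "q \<in> rho w ! s"
  shows "w ! (p - 1) \<le> w ! (q - 1) \<longleftrightarrow> r \<le> s"
proof -
  let ?l = "sorted_list_of_set (set w)"
  have mono: "i < j \<Longrightarrow> j < length ?l \<Longrightarrow> ?l ! i < ?l ! j" for i j
    using sorted_wrt_nth_less[OF strict_sorted_list_of_set] by blast
  have "length ?l = length (rho w)" by (simp add: length_rho)
  then have "?l ! r \<le> ?l ! s \<longleftrightarrow> r \<le> s"
    using mono[of r s] mono[of s r] assms(1,2) by (cases r s rule: linorder_cases) auto
  then show ?thesis using assms mem_rho_nth by metis
qed

lemma rho_eq_imp_same_order:
  assumes "rho u = rho w"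
  shows "same_order u w"
proof -
  \<comment> \<open>The blocks of \<open>rho\<close> have union \<open>{1..length u}\<close>, so its
    cardinality recovers the length.\<close>
  have len: "length u = length w"
    using Union_rho[of u] Union_rho[of w] assms by (metis card_atLeastAtMost diff_Suc_1)
  have "u ! p \<le> u ! q \<longleftrightarrow> w ! p \<le> w ! q" if "p < length w" "q < length w" for p q
  proof -
    have "Suc p \<in> {1..length w}" "Suc q \<in> {1..length w}" using that by auto
    then obtain r s where "r < length (rho w)" "Suc p \<in> rho w ! r"
      and "s < length (rho w)" "Suc q \<in> rho w ! s"
      using mem_rho_ex by blast
    then show ?thesis
      using rho_nth_le_iff[of r w s "Suc p" "Suc q"] rho_nth_le_iff[of r u s "Suc p" "Suc q"]
      by (simp add: assms)
  qed
  with len show ?thesis by (simp add: same_order_def)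
qed

lemma sorted_list_of_set_image_strict_mono:
  fixes f :: "'a::linorder \<Rightarrow> 'b::linorder"
  assumes "finite A" "strict_mono_on A f"
  shows "sorted_list_of_set (f ` A) = map f (sorted_list_of_set A)"
proof (rule sorted_distinct_set_unique)
  show "sorted (map f (sorted_list_of_set A))"
    using assms strict_mono_on_imp_mono_on[OF assms(2)]
    by (auto simp: sorted_map intro!: sorted_wrt_mono_rel[OF _ sorted_sorted_list_of_set]
        intro: monotone_onD)
  show "distinct (map f (sorted_list_of_set A))"
    using assms by (auto simp: distinct_map strict_mono_on_imp_inj_on)
qed (use assms in auto)

text \<open>The word \<open>w\<close> arises from \<open>u\<close> by a strictly increasing
  relabelling \<open>f\<close> of letters. Being injective, \<open>f\<close> keeps each block; being
  monotone, it keeps the order of the blocks.\<close>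

lemma same_order_imp_rho_eq:
  assumes "same_order u w"
  shows "rho u = rho w"
proof -
  have len: "length u = length w" using assms by (simp add: same_order_def)
  \<comment> \<open>Any occurrence of \<open>v\<close> in \<open>u\<close> would do: equal letters
    of \<open>u\<close> stand over equal letters of \<open>w\<close>, so \<open>f v\<close> does not
    depend on the choice.\<close>
  define pos where "pos v = (SOME p. p < length u \<and> u ! p = v)" for v
  define f where "f v = w ! pos v" for v
  have pos: "pos v < length u \<and> u ! pos v = v" if "v \<in> set u" for v
    unfolding pos_def by (rule someI_ex) (use that in \<open>auto simp: in_set_conv_nth\<close>)
  have f: "f (u ! p) = w ! p" if "p < length u" for p
    using pos[of "u ! p"] that len same_order_eq_iff[OF assms, of "pos (u ! p)" p]
    by (simp add: f_def)
  have w: "w = map f u" by (rule nth_equalityI) (simp_all add: len f)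
  have mono: "strict_mono_on (set u) f"
  proof (rule strict_mono_onI)
    fix a b assume "a \<in> set u" "b \<in> set u" "a < b"
    then show "f a < f b"
      using assms pos[of a] pos[of b] len unfolding same_order_def f_def by (metis not_le)
  qed
  have inj: "inj_on f (set u)" using mono by (rule strict_mono_on_imp_inj_on)
  have sets: "{i \<in> {1..length w}. w ! (i - 1) = f v} = {i \<in> {1..length u}. u ! (i - 1) = v}"
    if "v \<in> set u" for v
  proof -
    have "w ! (i - 1) = f v \<longleftrightarrow> u ! (i - 1) = v" if "i \<in> {1..length u}" for i
    proof -
      have "i - 1 < length u" using that by auto
      then show ?thesis using inj_on_eq_iff[OF inj, of "u ! (i - 1)" v] f[of "i - 1"] \<open>v \<in> set u\<close>
        by simp
    qed
    then show ?thesis by (auto simp: len)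
  qed
  have "sorted_list_of_set (set w) = map f (sorted_list_of_set (set u))"
    using sorted_list_of_set_image_strict_mono[OF _ mono] by (simp add: w)
  then show ?thesis
    using sets by (simp add: rho_def)
qed

section \<open>Standardization in terms of comparisons\<close>

lemma std_cong_same_order:
  assumes "same_order u w"
  shows "std u = std w"
proof
  fix i
  have len: "length u = length w" using assms by (simp add: same_order_def)
  show "std u i = std w i"
  proof (cases "i \<in> {1..length w}")
    case True
    have lt: "u ! (j - 1) < u ! (i - 1) \<longleftrightarrow> w ! (j - 1) < w ! (i - 1)"
      and eq: "u ! (j - 1) = u ! (i - 1) \<longleftrightarrow> w ! (j - 1) = w ! (i - 1)"
      if "j \<in> {1..length w}" for j
    proof -
      have "i - 1 < length w" "j - 1 < length w" using True that by auto
      then show "u ! (j - 1) < u ! (i - 1) \<longleftrightarrow> w ! (j - 1) < w ! (i - 1)"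
        and "u ! (j - 1) = u ! (i - 1) \<longleftrightarrow> w ! (j - 1) = w ! (i - 1)"
        using assms same_order_eq_iff[OF assms] unfolding same_order_def
        by (metis not_le, metis)
    qed
    have "{j \<in> {1..length w}. u ! (j - 1) < u ! (i - 1) \<or> (u ! (j - 1) = u ! (i - 1) \<and> j \<le> i)} =
          {j \<in> {1..length w}. w ! (j - 1) < w ! (i - 1) \<or> (w ! (j - 1) = w ! (i - 1) \<and> j \<le> i)}"
      using lt eq by blast
    then show ?thesis using True unfolding std_def len by simp
  next
    case False
    show ?thesis unfolding std_def len if_not_P[OF False] ..
  qed
qed

text \<open>By contraposition: if \<open>q\<close> comes weakly before \<open>p\<close> in the order
  by letter, then position, every position counted for \<open>q\<close> is also counted for
  \<open>p\<close>.\<close>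

lemma std_less_imp:
  assumes "p \<in> {1..length w}" "q \<in> {1..length w}" "std w p < std w q"
  shows "w ! (p - 1) < w ! (q - 1) \<or> (w ! (p - 1) = w ! (q - 1) \<and> p < q)"
proof (rule ccontr)
  assume neg: "\<not> ?thesis"
  have "std w q \<le> std w p"
    using assms(1,2) neg unfolding std_def by (auto intro!: card_mono)
  with assms(3) show False by simp
qed

text \<open>\<open>std w\<close> ranks positions lexicographically by letter, then position. It
  equals \<open>\<tau>\<close> iff \<open>inv \<tau>\<close> enumerates the positions in increasing
  order, and by transitivity neighbours suffice to test this.\<close>

lemma std_eq_permutation_iff:
  assumes perm: "\<tau> permutes {1..length w}"
  shows "std w = \<tau> \<longleftrightarrow>
    (\<forall>i. 1 \<le> i \<and> i < length w \<longrightarrow>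
      w ! (inv \<tau> i - 1) < w ! (inv \<tau> (Suc i) - 1) \<or>
      (w ! (inv \<tau> i - 1) = w ! (inv \<tau> (Suc i) - 1) \<and> inv \<tau> i < inv \<tau> (Suc i)))"
    (is "_ \<longleftrightarrow> (\<forall>i. ?range i \<longrightarrow> ?lt i (Suc i))")
proof
  have inv_perm: "inv \<tau> permutes {1..length w}" using perm by (rule permutes_inv)
  have inv_mem: "inv \<tau> i \<in> {1..length w}" if "i \<in> {1..length w}" for i
    using permutes_in_image[OF inv_perm] that by blast
  {
    assume std: "std w = \<tau>"
    show "\<forall>i. ?range i \<longrightarrow> ?lt i (Suc i)"
    proof (intro allI impI)
      fix i assume "?range i"
      then have "inv \<tau> i \<in> {1..length w}" "inv \<tau> (Suc i) \<in> {1..length w}"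
        using inv_mem[of i] inv_mem[of "Suc i"] by auto
      then show "?lt i (Suc i)"
        by (rule std_less_imp) (simp add: std permutes_inverses(1)[OF perm])
    qed
  next
    assume step: "\<forall>i. ?range i \<longrightarrow> ?lt i (Suc i)"
    have lt: "?lt i j" if "i < j" "1 \<le> i" "j \<le> length w" for i j
      using that
    proof (induction j rule: less_induct)
      case (less j)
      then obtain k where k: "j = Suc k" by (cases j) auto
      have "?lt k (Suc k)" using step less.prems k by auto
      moreover have "k = i \<or> ?lt i k" using less.IH[of k] less.prems k by auto
      ultimately show ?case unfolding k by auto
    qed
    have le: "w ! (inv \<tau> i - 1) < w ! (inv \<tau> j - 1) \<or>
        (w ! (inv \<tau> i - 1) = w ! (inv \<tau> j - 1) \<and> inv \<tau> i \<le> inv \<tau> j) \<longleftrightarrow> i \<le> j"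
      if "i \<in> {1..length w}" "j \<in> {1..length w}" for i j
      using lt[of i j] lt[of j i] that by (cases i j rule: linorder_cases) auto
    show "std w = \<tau>"
    proof
      fix p
      show "std w p = \<tau> p"
      proof (cases "p \<in> {1..length w}")
        case True
        define j where "j = \<tau> p"
        have j: "j \<in> {1..length w}" using permutes_in_image[OF perm] True by (simp add: j_def)
        have p: "p = inv \<tau> j" by (simp add: j_def permutes_inverses(2)[OF perm])
        let ?S = "{q \<in> {1..length w}. w ! (q - 1) < w ! (p - 1) \<or>
                     (w ! (q - 1) = w ! (p - 1) \<and> q \<le> p)}"
        \<comment> \<open>The positions weakly before the \<open>j\<close>-th one are exactly the
          first \<open>j\<close> enumerated, so the count defining \<open>std w p\<close> is
          \<open>j\<close>.\<close>
        have "?S = inv \<tau> ` {1..j}"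
        proof (intro equalityI subsetI)
          fix q assume q: "q \<in> ?S"
          then have "\<tau> q \<in> {1..length w}" "q = inv \<tau> (\<tau> q)"
            using permutes_in_image[OF perm, of q] by (auto simp: permutes_inverses(2)[OF perm])
          moreover from this have "\<tau> q \<le> j" using le[of "\<tau> q" j] j q p by simp
          ultimately show "q \<in> inv \<tau> ` {1..j}" by auto
        next
          fix q assume "q \<in> inv \<tau> ` {1..j}"
          then obtain i where i: "i \<in> {1..j}" "q = inv \<tau> i" by auto
          then show "q \<in> ?S" using le[of i j] inv_mem[of i] j p by auto
        qed
        moreover have "card (inv \<tau> ` {1..j}) = j"
          using card_image[OF inj_on_subset[OF permutes_inj[OF inv_perm] subset_UNIV]] by simp
        ultimately show ?thesis using True by (simp add: std_def j_def)
      next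
        case False
        \<comment> \<open>Outside \<open>{1..length w}\<close> both functions fix every
          point.\<close>
        then show ?thesis using permutes_not_in[OF perm False] by (auto simp: std_def)
      qed
    qed
  }
qed

section \<open>Fillings of the composition into singletons, read as words\<close>

context
  fixes n :: nat and \<tau> :: "nat \<Rightarrow> nat"
  assumes perm: "\<tau> permutes {1..n}"
  notes upt_Suc [simp del]
begin

private definition singletons :: "nat set list" where
  "singletons = map (\<lambda>i. {inv \<tau> i}) [1..<Suc n]"

text \<open>The letter at position \<open>p\<close> is the column containing \<open>p\<close>: row
  \<open>i\<close>, counted from 0, holds \<open>inv \<tau> (Suc i)\<close>, so \<open>p\<close>
  lies in row \<open>\<tau> p - 1\<close>.\<close>

private definition filling_word :: "nat list \<Rightarrow> nat list" where
  "filling_word c = map (\<lambda>p. c ! (\<tau> p - 1)) [1..<Suc n]"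

private lemma inv_mem: "i < n \<Longrightarrow> inv \<tau> (Suc i) \<in> {1..n}"
  using permutes_in_image[OF permutes_inv[OF perm], of "Suc i"] by auto

private lemma nth_singletons: "i < n \<Longrightarrow> singletons ! i = {inv \<tau> (Suc i)}"
  by (simp add: singletons_def)

private lemma length_singletons: "length singletons = n"
  by (simp add: singletons_def)

private lemma length_filling_word: "length (filling_word c) = n"
  by (simp add: filling_word_def)

private lemma filling_word_nth: "p \<in> {1..n} \<Longrightarrow> filling_word c ! (p - 1) = c ! (\<tau> p - 1)"
  by (auto simp: filling_word_def)

private lemma filling_word_nth_inv:
  "i < n \<Longrightarrow> filling_word c ! (inv \<tau> (Suc i) - 1) = c ! i"
  using filling_word_nth[OF inv_mem] by (simp add: permutes_inverses(1)[OF perm])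

private lemma position_obtain:
  assumes "p \<in> {1..n}"
  obtains i where "i < n" "p = inv \<tau> (Suc i)"
proof
  have "\<tau> p \<in> {1..n}" using permutes_in_image[OF perm] assms by blast
  then show "\<tau> p - 1 < n" "p = inv \<tau> (Suc (\<tau> p - 1))"
    by (auto simp: permutes_inverses(2)[OF perm])
qed

private lemma index_obtain:
  assumes "p < n"
  obtains i where "i < n" "p = inv \<tau> (Suc i) - 1"
proof -
  have "Suc p \<in> {1..n}" using assms by simp
  then obtain i where "i < n" "Suc p = inv \<tau> (Suc i)" by (rule position_obtain)
  then show thesis using that[of i] by simp
qed

private lemma set_filling_word:
  assumes "length c = n"
  shows "set (filling_word c) = set c"
proof
  show "set (filling_word c) \<subseteq> set c"
  proof
    fix x assume "x \<in> set (filling_word c)"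
    then obtain p where "p < n" "x = filling_word c ! p"
      by (auto simp: in_set_conv_nth length_filling_word)
    then show "x \<in> set c" using assms by (metis index_obtain filling_word_nth_inv nth_mem)
  qed
  show "set c \<subseteq> set (filling_word c)"
  proof
    fix x assume "x \<in> set c"
    then obtain i where i: "i < n" "x = c ! i" using assms by (auto simp: in_set_conv_nth)
    then have "inv \<tau> (Suc i) - 1 < length (filling_word c)"
      using inv_mem[of i] by (auto simp: length_filling_word)
    then show "x \<in> set (filling_word c)" using i filling_word_nth_inv by (metis nth_mem)
  qed
qed

text \<open>Letters of the filling word are column numbers, so the union of a column is the set of
  positions of one letter. This turns the index of each \<open>M\<close> in \<open>P\<close> into
  the \<open>rho\<close> of a word.\<close>

private lemma col_singletons:
  assumes "length c = n"
  shows "col singletons c = rho (filling_word c)"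
proof -
  have "\<Union>{singletons ! i | i. i < length singletons \<and> c ! i = k} =
        {p \<in> {1..length (filling_word c)}. filling_word c ! (p - 1) = k}" (is "?L = ?R") for k
  proof (intro equalityI subsetI)
    fix p assume "p \<in> ?L"
    then obtain i where "i < n" "c ! i = k" "p = inv \<tau> (Suc i)"
      by (auto simp: length_singletons nth_singletons)
    then show "p \<in> ?R"
      using inv_mem[of i] filling_word_nth_inv[of i c] by (simp add: length_filling_word)
  next
    fix p assume p: "p \<in> ?R"
    then obtain i where i: "i < n" "p = inv \<tau> (Suc i)"
      unfolding length_filling_word by (blast elim: position_obtain)
    then have "c ! i = k" using p filling_word_nth_inv[of i c] by simp
    with i have "singletons ! i \<in> {singletons ! i | i. i < length singletons \<and> c ! i = k}"
      by (auto simp: length_singletons)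
    with i nth_singletons[of i] show "p \<in> ?L" by blast
  qed
  then show ?thesis
    by (simp add: col_def rho_def set_filling_word[OF assms])
qed

text \<open>All blocks have cardinality 1, so \<open>block_gt\<close> compares their elements, and a
  column can be kept only at an ascent of \<open>inv \<tau>\<close>.\<close>

private lemma mem_LDD_singletons:
  "c \<in> LDD singletons \<longleftrightarrow> length c = n \<and> (0 < n \<longrightarrow> c ! 0 = 1) \<and>
     (\<forall>i. Suc i < n \<longrightarrow>
        c ! Suc i = c ! i \<and> inv \<tau> (Suc i) < inv \<tau> (Suc (Suc i)) \<or> c ! Suc i = c ! i + 1)"
  \<comment> \<open>Nonemptiness becomes a condition on the length, which is known to be
    \<open>n\<close>.\<close>
  unfolding LDD_def length_0_conv[symmetric]
  by (auto simp: block_gt_def nth_singletons length_singletons)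

text \<open>Moving to the next column is a strict increase, and staying requires an ascent of
  \<open>inv \<tau>\<close>: these are the two alternatives of
  \<open>std_eq_permutation_iff\<close>.\<close>

private lemma std_filling_word:
  assumes "c \<in> LDD singletons"
  shows "std (filling_word c) = \<tau>"
proof -
  have "filling_word c ! (inv \<tau> i - 1) < filling_word c ! (inv \<tau> (Suc i) - 1) \<or>
      (filling_word c ! (inv \<tau> i - 1) = filling_word c ! (inv \<tau> (Suc i) - 1) \<and>
       inv \<tau> i < inv \<tau> (Suc i))" if i: "1 \<le> i" "i < n" for i
  proof -
    obtain k where k: "i = Suc k" using i by (cases i) auto
    then show ?thesis
      using assms i filling_word_nth_inv[of k c] filling_word_nth_inv[of "Suc k" c]
      by (auto simp: mem_LDD_singletons)
  qed
  then show ?thesis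
    using std_eq_permutation_iff[of \<tau> "filling_word c"] perm by (simp add: length_filling_word)
qed

private lemma same_order_filling_wordI:
  assumes w: "length w = n"
    and le: "\<And>i j. i < n \<Longrightarrow> j < n \<Longrightarrow>
      c ! i \<le> c ! j \<longleftrightarrow> w ! (inv \<tau> (Suc i) - 1) \<le> w ! (inv \<tau> (Suc j) - 1)"
  shows "same_order (filling_word c) w"
  unfolding same_order_def
proof (intro conjI allI impI)
  show "length (filling_word c) = length w" by (simp add: w length_filling_word)
  fix p q assume "p < length w" "q < length w"
  then obtain i j where "i < n" "p = inv \<tau> (Suc i) - 1" "j < n" "q = inv \<tau> (Suc j) - 1"
    unfolding w by (blast elim: index_obtain)
  then show "filling_word c ! p \<le> filling_word c ! q \<longleftrightarrow> w ! p \<le> w ! q"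
    using le by (simp add: filling_word_nth_inv del: One_nat_def)
qed

text \<open>The filling is the packing of \<open>w\<close>, built row by row: a new column starts
  exactly where the letter strictly increases.\<close>

private lemma filling_word_exists:
  assumes w: "length w = n" and std: "std w = \<tau>"
  shows "\<exists>c \<in> LDD singletons. same_order (filling_word c) w"
proof -
  define a where "a i = w ! (inv \<tau> (Suc i) - 1)" for i
  \<comment> \<open>One plus the number of strict rises of \<open>a\<close> before \<open>i\<close>,
    which is the rank of \<open>a i\<close> among the distinct letters for \<open>i < n\<close>. The
    \<open>Suc\<close> makes the first column 1.\<close>
  define g where "g i = Suc (card {j. j < i \<and> a j < a (Suc j)})" for i
  define c where "c = map g [0..<n]"
  have a_step: "a i < a (Suc i) \<or> a i = a (Suc i) \<and> inv \<tau> (Suc i) < inv \<tau> (Suc (Suc i))"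
    if "Suc i < n" for i
    using std_eq_permutation_iff[of \<tau> w] perm w std that by (auto simp: a_def)
  have g_step: "g (Suc i) = (if a i < a (Suc i) then Suc (g i) else g i)" for i
  proof -
    have "{j. j < Suc i \<and> a j < a (Suc j)} =
        (if a i < a (Suc i) then insert i else id) {j. j < i \<and> a j < a (Suc j)}"
      by (auto simp: less_Suc_eq)
    then show ?thesis by (simp add: g_def)
  qed
  have "c \<in> LDD singletons"
    using a_step by (auto simp: mem_LDD_singletons c_def g_step) (simp_all add: g_def)
  \<comment> \<open>Going up from \<open>i\<close> to \<open>j\<close>, both sequences increase
    weakly and rise at the same steps, so they agree on every comparison.\<close>
  moreover have "g i \<le> g j \<and> a i \<le> a j \<and> (g i = g j \<longleftrightarrow> a i = a j)" if "i \<le> j" "j < n" for i j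
    using that
  proof (induction j rule: dec_induct)
    case (step k)
    then show ?case using a_step[of k] by (auto simp: g_step)
  qed simp
  then have "g i \<le> g j \<longleftrightarrow> a i \<le> a j" if "i < n" "j < n" for i j
    using that by (metis nle_le)
  then have "same_order (filling_word c) w"
    by (intro same_order_filling_wordI[OF w]) (simp add: c_def a_def)
  ultimately show ?thesis by blast
qed

text \<open>Columns start at 1 and grow by 0 or 1, so a filling is determined by which neighbouring
  rows share a column, and \<open>same_order\<close> preserves these equalities.\<close>

private lemma filling_word_unique:
  assumes c: "c \<in> LDD singletons" and d: "d \<in> LDD singletons"
    and "same_order (filling_word c) (filling_word d)"
  shows "c = d"
proof (rule nth_equalityI)
  have len: "length c = n" "length d = n" using c d by (simp_all add: mem_LDD_singletons)
  then show "length c = length d" by simp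
  have eq: "c ! i = c ! j \<longleftrightarrow> d ! i = d ! j" if "i < n" "j < n" for i j
  proof -
    have "inv \<tau> (Suc i) - 1 < n" "inv \<tau> (Suc j) - 1 < n"
      using inv_mem[OF that(1)] inv_mem[OF that(2)] by auto
    then show ?thesis
      using same_order_eq_iff[OF assms(3)] that
      by (metis filling_word_nth_inv length_filling_word)
  qed
  show "c ! i = d ! i" if "i < length c" for i
    using that
  proof (induction i)
    case 0
    then show ?case using c d by (auto simp: mem_LDD_singletons)
  next
    case (Suc i)
    then have "c ! Suc i = c ! i \<or> c ! Suc i = c ! i + 1"
      "d ! Suc i = d ! i \<or> d ! Suc i = d ! i + 1"
      using c d len by (auto simp: mem_LDD_singletons)
    then show ?case using Suc eq[of "Suc i" i] len by auto
  qed
qed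

section \<open>Comparison of coefficients\<close>

text \<open>For a positive word this is the coefficient of its monomial in
  \<open>P singletons\<close>: the fillings counted are those whose filling word has the same
  packing as \<open>w\<close>.\<close>

private lemma card_fillings_of_word:
  "card {c \<in> LDD singletons. rho w = col singletons c} =
     (if length w = n \<and> std w = \<tau> then 1 else 0)"
proof -
  have iff: "rho w = col singletons c \<longleftrightarrow> same_order (filling_word c) w"
    if "c \<in> LDD singletons" for c
    using that rho_eq_imp_same_order same_order_imp_rho_eq same_order_sym
    by (metis col_singletons mem_LDD_singletons)
  have fillings: "{c \<in> LDD singletons. rho w = col singletons c} =
      {c \<in> LDD singletons. same_order (filling_word c) w}"
    using iff by blast
  show ?thesis
  proof (cases "length w = n \<and> std w = \<tau>")
    case True
    then obtain c where "{c \<in> LDD singletons. same_order (filling_word c) w} = {c}"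
      using filling_word_exists[of w] filling_word_unique same_order_trans same_order_sym
      by blast
    with True show ?thesis by (simp add: fillings)
  next
    case False
    \<comment> \<open>A filling word with the same comparisons would pass its length
      \<open>n\<close> and standardization \<open>\<tau>\<close> on to \<open>w\<close>.\<close>
    have "\<not> same_order (filling_word c) w" if "c \<in> LDD singletons" for c
      using std_filling_word[OF that] std_cong_same_order[of "filling_word c" w] False
      by (auto simp: same_order_def length_filling_word)
    then have "{c \<in> LDD singletons. same_order (filling_word c) w} = {}" by blast
    with False show ?thesis by (simp only: fillings card.empty if_False)
  qed
qed

lemma FQSym_F_eq_P:
  "(FQSym_F n \<tau> :: 'a::comm_ring_1 nc_series) = P (map (\<lambda>i. {inv \<tau> i}) [1..<Suc n])"
  unfolding singletons_def[symmetric]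
proof
  fix w
  have "P singletons w =
      (\<Sum>c\<in>LDD singletons. if pos_word w \<and> rho w = col singletons c then 1 else (0::'a))"
    by (simp add: P_def M_def monomial_sum_def)
  \<comment> \<open>Positivity of \<open>w\<close> does not depend on the filling and leaves the
    sum; the remaining indicators add up to a cardinality.\<close>
  also have "\<dots> = (if pos_word w
      then of_nat (card {c \<in> LDD singletons. rho w = col singletons c}) else 0)"
    using finite_LDD[of singletons] by (simp add: sum.inter_filter[symmetric])
  also have "\<dots> = FQSym_F n \<tau> w"
    by (simp add: card_fillings_of_word FQSym_F_def monomial_sum_def)
  finally show "FQSym_F n \<tau> w = (P singletons w :: 'a)" by simp
qed

end

theorem theorem4p8:
  fixes n :: nat and \<tau> :: "nat \<Rightarrow> nat"
  assumes "\<tau> permutes {1..n}"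
  shows "(FQSym_F n \<tau> :: 'a::comm_ring_1 nc_series) =
           P (map (\<lambda>i. {inv \<tau> i}) [1..<Suc n])"
  using assms by (rule FQSym_F_eq_P)

end
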